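(* Let $(\Omega,\mu,d)$ be a metric measure space satisfying the standing assumptions, with isoperimetric profile $I$, and suppose that $\mu(\Omega)<\infty$. Then for every Lipschitz function $f\in Lip(\Omega)$, every median $m(f)$ of $f$, and every measurable set $A\subset\Omega$, $$\int_{A}|f-m(f)|\,d\mu\le \frac{\min\{\mu(A),\mu(\Omega)/2\}}{I(\min\{\mu(A),\mu(\Omega)/2\})}\int_{\Omega}|\nabla f|\,d\mu .$$
   Context: Setting and standing assumptions. $(\Omega,\mu,d)$ is a connected metric space with a Borel measure $\mu$ such that $\mu(K)<\infty$ for every compact $K\subset\Omega$. $Lip(\Omega)$ is the set of real-valued Lipschitz functions on $\Omega$. For $f\in Lip(\Omega)$, $|\nabla f(x)|=\limsup_{d(x,y)\to0}\frac{|f(x)-f(y)|}{d(x,y)}$. For a Borel set $A\subset\Omega$, its perimeter (Minkowski content) is $\mu^+(A)=\liminf_{h\to0}\frac{\mu(A_h)-\mu(A)}{h}$, where $A_h=\{x\in\Omega:d(x,A)<h\}$. The isoperimetric profile is $I:[0,\mu(\Omega))\to\mathbb{R}_+$, $I(t)=\inf\{\mu^+(A):\mu(A)=t\}$. It is assumed throughout that $I$ is concave, continuous and $I(0)=0$; when $\mu(\Omega)<\infty$ it is also assumed that $I$ is symmetric around $\mu(\Omega)/2$ (so $I$ is increasing on $(0,\mu(\Omega)/2)$ and decreasing on $(\mu(\Omega)/2,\mu(\Omega))$). It is understood that $I>0$ on $(0,\mu(\Omega))$, and the quotient $t/I(t)$ is read as $0$ at $t=0$. Median. A real number $m(f)$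 is a median of an integrable $f:\Omega\to\mathbb{R}$ if $\mu\{f\ge m(f)\}\ge\mu(\Omega)/2$ and $\mu\{f\le m(f)\}\ge\mu(\Omega)/2$. *)

theory Defs
  imports "HOL-Analysis.Analysis"
begin

text \<open>The metric space is the whole type. The guard \<open>A \<noteq> {}\<close> encodes the
  convention that the distance to the empty set is infinite; in the library
  \<open>infdist x {} = 0\<close>.\<close>

definition enlargement :: "'a::metric_space set \<Rightarrow> real \<Rightarrow> 'a set" where
  "enlargement A h = {x. A \<noteq> {} \<and> infdist x A < h}"

definition perimeter :: "'a::metric_space measure \<Rightarrow> 'a set \<Rightarrow> ennreal" where
  "perimeter M A =
     Liminf (at_right 0) (\<lambda>h. (emeasure M (enlargement A h) - emeasure M A) / ennreal h)"

text \<open>The infimum is taken in \<^typ>\<open>ennreal\<close>, so that it is \<open>\<top>\<close> when no Borel set of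
  measure \<open>t\<close> exists. The locale below requires it to be finite on the domain of the
  profile, and only then is the real-valued version meaningful.\<close>

definition ext_profile :: "'a::metric_space measure \<Rightarrow> real \<Rightarrow> ennreal" where
  "ext_profile M t = (INF A\<in>{A \<in> sets M. emeasure M A = ennreal t}. perimeter M A)"

definition iso_profile :: "'a::metric_space measure \<Rightarrow> real \<Rightarrow> real" where
  "iso_profile M t = enn2real (ext_profile M t)"

text \<open>The interval \<open>[0, \<mu>(\<Omega>))\<close>, allowing infinite total measure.\<close>

definition profile_dom :: "'a measure \<Rightarrow> real set" where
  "profile_dom M = {t. 0 \<le> t \<and> ennreal t < emeasure M (space M)}"

locale isoperimetric_space =
  fixes M :: "'a::metric_space measure"
  assumes connected_space: "connected (UNIV :: 'a set)"
    and sets_borel: "sets M = sets borel"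
    and finite_on_compact: "\<And>K. compact K \<Longrightarrow> emeasure M K < \<infinity>"
    and profile_finite: "\<And>t. t \<in> profile_dom M \<Longrightarrow> ext_profile M t < \<infinity>"
    and profile_concave: "concave_on (profile_dom M) (iso_profile M)"
    and profile_continuous: "continuous_on (profile_dom M) (iso_profile M)"
    and profile_zero: "iso_profile M 0 = 0"
    and profile_pos: "\<And>t. t \<in> profile_dom M \<Longrightarrow> 0 < t \<Longrightarrow> 0 < iso_profile M t"
    and profile_symmetric:
      "\<And>t. emeasure M (space M) < \<infinity> \<Longrightarrow> 0 < t \<Longrightarrow> t < measure M (space M) \<Longrightarrow>
        iso_profile M (measure M (space M) - t) = iso_profile M t"

text \<open>The modulus of the gradient. For Lipschitz functions it is finite. Taking the
  upper limit in \<^typ>\<open>ennreal\<close> gives 0 at isolated points.\<close>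

definition grad_norm :: "('a::metric_space \<Rightarrow> real) \<Rightarrow> 'a \<Rightarrow> ennreal" where
  "grad_norm f x = Limsup (at x) (\<lambda>y. ennreal (\<bar>f x - f y\<bar> / dist x y))"

text \<open>No integrability of \<open>f\<close> is required, since the two conditions make sense for
  every measurable \<open>f\<close>.\<close>

definition is_median :: "'a measure \<Rightarrow> ('a \<Rightarrow> real) \<Rightarrow> real \<Rightarrow> bool" where
  "is_median M f m \<longleftrightarrow>
     emeasure M {x \<in> space M. f x \<ge> m} \<ge> emeasure M (space M) / 2 \<and>
     emeasure M {x \<in> space M. f x \<le> m} \<ge> emeasure M (space M) / 2"

end

theory Submission
  imports Defs
begin

text \<open>The argument is a coarea inequality followed by a level-by-level comparison. Put
  \<open>f\<^sub>h x = sup {f y | d x y < h}\<close>. Then \<open>{f\<^sub>h > s}\<close> is the enlargement of \<open>{f > s}\<close>, so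
  the layer-cake formula turns the integral of \<open>(f\<^sub>h - f) / h\<close> into the integral over \<open>s\<close>
  of the difference quotients of the perimeters of \<open>{f > s}\<close>, and Fatou's lemma is applied
  on both sides as \<open>h \<rightarrow> 0\<close>. On the other side, the layers of \<open>\<bar>f - m\<bar>\<close> on \<open>A\<close> are
  \<open>A \<inter> {f > s}\<close> for \<open>s \<ge> m\<close> and \<open>A \<inter> {f \<le> s}\<close> for \<open>s < m\<close>; concavity and symmetry of the
  profile bound the measure of each by \<open>t / I t\<close> times the perimeter of \<open>{f > s}\<close>. Working
  with \<open>f\<close> at all levels, rather than with the two parts of \<open>f - m\<close>, avoids having to
  control the gradients on \<open>{f = m}\<close>.\<close>

section \<open>Enlargements and suprema over balls\<close>

definition sup_ball :: "('a::metric_space \<Rightarrow> real) \<Rightarrow> real \<Rightarrow> 'a \<Rightarrow> real" where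
  "sup_ball f h x = (SUP y\<in>ball x h. f y)"

lemma enlargement_eq_UN_ball: "enlargement A h = (\<Union>a\<in>A. ball a h)"
proof (cases "A = {}")
  case False
  then show ?thesis
    unfolding enlargement_def infdist_notempty[OF False]
    by (auto simp: cInf_less_iff cINF_less_iff dist_commute)
qed (simp add: enlargement_def)

lemma open_enlargement: "open (enlargement A h)"
  by (auto simp: enlargement_eq_UN_ball)

context
  fixes f :: "'a::metric_space \<Rightarrow> real" and L :: real
  assumes lip: "L-lipschitz_on UNIV f"
begin

lemma lipschitz_le_ball:
  assumes "y \<in> ball x h"
  shows "f y \<le> f x + L * h"
proof -
  have "\<bar>f y - f x\<bar> \<le> L * dist y x"
    using lipschitz_onD[OF lip, of y x] by (simp add: dist_real_def)
  also have "\<dots> \<le> L * h"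
    using assms lipschitz_on_nonneg[OF lip] by (intro mult_left_mono) (auto simp: dist_commute)
  finally show ?thesis by simp
qed

text \<open>The real-valued supremum in \<open>sup_ball\<close> is meaningful only for a bounded
  image.\<close>

lemma bdd_above_image_ball: "bdd_above (f ` ball x h)"
  using lipschitz_le_ball by (intro bdd_aboveI2)

lemma sup_ball_upper: "0 < h \<Longrightarrow> f x \<le> sup_ball f h x"
  unfolding sup_ball_def by (rule cSUP_upper[OF _ bdd_above_image_ball]) auto

lemma sup_ball_le: "0 < h \<Longrightarrow> sup_ball f h x \<le> f x + L * h"
  unfolding sup_ball_def using lipschitz_le_ball by (intro cSUP_least) auto

text \<open>A supremum exceeds \<open>s\<close> exactly when some value does; open balls match the
  strict inequality in \<open>enlargement\<close>.\<close>

lemma superlevel_sup_ball: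
  assumes "0 < h"
  shows "{x. s < sup_ball f h x} = enlargement {x. s < f x} h"
proof -
  have "s < sup_ball f h x \<longleftrightarrow> (\<exists>y\<in>ball x h. s < f y)" for x
    unfolding sup_ball_def using assms by (intro less_cSUP_iff bdd_above_image_ball) auto
  then show ?thesis
    by (auto simp: enlargement_eq_UN_ball dist_commute)
qed

lemma borel_measurable_sup_ball: "0 < h \<Longrightarrow> sup_ball f h \<in> borel_measurable borel"
  by (intro borel_measurableI_greater)
    (simp add: superlevel_sup_ball open_enlargement)

text \<open>If a finite \<open>S\<close> bounds the difference quotients on the punctured ball of
  radius \<open>d\<close>, then \<open>f y \<le> f x + S * k\<close> on every ball of radius
  \<open>k < d\<close>, because \<open>dist x y < k\<close> there. The upper limit in
  \<open>grad_norm\<close> is the infimum of such bounds.\<close>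

lemma limsup_sup_ball_le_grad_norm:
  assumes pos: "\<And>n. 0 < h n" and lim: "h \<longlonglongrightarrow> 0"
  shows "limsup (\<lambda>n. ennreal ((sup_ball f (h n) x - f x) / h n)) \<le> grad_norm f x"
  unfolding grad_norm_def
proof (rule Limsup_greatest)
  fix P assume "eventually P (at x)"
  then obtain d where d: "d > 0" "\<And>y. y \<noteq> x \<Longrightarrow> dist y x < d \<Longrightarrow> P y"
    by (auto simp: eventually_at)
  define S where "S = (SUP y\<in>Collect P. ennreal (\<bar>f x - f y\<bar> / dist x y))"
  have "ennreal ((sup_ball f k x - f x) / k) \<le> S" if k: "0 < k" "k < d" for k
  proof (cases S)
    case (real c)
    have "f y \<le> f x + c * k" if y: "y \<in> ball x k" for y
    proof (cases "y = x")
      case False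
      then have "P y" using d y k by (auto simp: dist_commute)
      then have "ennreal (\<bar>f x - f y\<bar> / dist x y) \<le> S"
        unfolding S_def by (intro SUP_upper) auto
      then have "\<bar>f x - f y\<bar> / dist x y \<le> c" using real by simp
      then have "\<bar>f x - f y\<bar> \<le> c * dist x y" using False by (simp add: divide_simps)
      also have "\<dots> \<le> c * k" using y real by (intro mult_left_mono) auto
      finally show ?thesis by simp
    qed (use real k in simp)
    then have "sup_ball f k x \<le> f x + c * k"
      unfolding sup_ball_def using k by (intro cSUP_least) auto
    then have "(sup_ball f k x - f x) / k \<le> c" using k by (simp add: divide_simps algebra_simps)
    then show ?thesis using real by (simp add: ennreal_leI)
  qed simp
  then show "limsup (\<lambda>n. ennreal ((sup_ball f (h n) x - f x) / h n)) \<le> S"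
    using order_tendstoD(2)[OF lim \<open>d > 0\<close>] pos
    by (intro Limsup_bounded) (auto elim!: eventually_mono)
qed

end

text \<open>The equality \<open>nn_integral_cmult\<close> needs a measurable integrand, but it is not clear
  that the perimeter of the superlevel set \<open>{f > s}\<close> is measurable in \<open>s\<close>.\<close>

lemma nn_integral_cmult_le:
  assumes c: "0 < c" "c < \<infinity>"
  shows "(\<integral>\<^sup>+x. c * g x \<partial>N) \<le> c * (\<integral>\<^sup>+x. g x \<partial>N)"
  unfolding nn_integral_def[of N "\<lambda>x. c * g x"]
proof (rule SUP_least)
  fix \<phi> assume "\<phi> \<in> {\<phi>. simple_function N \<phi> \<and> \<phi> \<le> (\<lambda>x. c * g x)}"
  then have \<phi>: "simple_function N \<phi>" "\<And>x. \<phi> x \<le> c * g x"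
    by (auto simp: le_fun_def)
  have [measurable]: "\<phi> \<in> borel_measurable N"
    using \<phi>(1) by (rule borel_measurable_simple_function)
  have "integral\<^sup>S N \<phi> = (\<integral>\<^sup>+x. \<phi> x \<partial>N)" using \<phi>(1) by (simp add: nn_integral_eq_simple_integral)
  \<comment> \<open>The quotient \<open>\<phi> x / c\<close> is measurable and lies below
    \<open>g\<close>, so the constant can be pulled out for it.\<close>
  also have "\<dots> = (\<integral>\<^sup>+x. c * (\<phi> x / c) \<partial>N)"
    using c by (simp add: ennreal_times_divide mult.commute[of c] mult_divide_eq_ennreal)
  also have "\<dots> = c * (\<integral>\<^sup>+x. \<phi> x / c \<partial>N)" by (rule nn_integral_cmult) measurable
  also have "\<dots> \<le> c * (\<integral>\<^sup>+x. g x \<partial>N)"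
  proof (intro mult_left_mono nn_integral_mono)
    fix x
    have "\<phi> x / c \<le> (g x * c) / c" using \<phi>(2)[of x] by (intro divide_right_mono_ennreal) (simp add: mult.commute)
    also have "\<dots> = g x" using c by (intro mult_divide_eq_ennreal) auto
    finally show "\<phi> x / c \<le> g x" .
  qed simp
  finally show "integral\<^sup>S N \<phi> \<le> c * integral\<^sup>N N g" .
qed

section \<open>Layer-cake formula\<close>

context finite_measure
begin

text \<open>Fubini for the indicator of the region between the graphs. Where
  \<open>g x < f x\<close> the interval of levels is empty, in agreement with \<open>ennreal\<close>
  sending negative numbers to 0.\<close>

lemma
  fixes f g :: "'a \<Rightarrow> real"
  assumes [measurable]: "f \<in> borel_measurable M" "g \<in> borel_measurable M"
  shows layer_cake_diff: "(\<integral>\<^sup>+x. ennreal (g x - f x) \<partial>M)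
      = (\<integral>\<^sup>+s. emeasure M {x \<in> space M. f x \<le> s \<and> s < g x} \<partial>lborel)"
    and borel_measurable_layer:
      "(\<lambda>s. emeasure M {x \<in> space M. f x \<le> s \<and> s < g x}) \<in> borel_measurable borel"
proof -
  interpret pair_sigma_finite M lborel ..
  let ?i = "\<lambda>x s. indicator {s. f x \<le> s \<and> s < g x} s :: ennreal"
  have [measurable]: "case_prod ?i \<in> borel_measurable (M \<Otimes>\<^sub>M lborel)"
    by (simp add: indicator_def case_prod_beta') measurable
  have layer: "(\<integral>\<^sup>+x. ?i x s \<partial>M) = emeasure M {x \<in> space M. f x \<le> s \<and> s < g x}" for s
  proof -
    have "(\<integral>\<^sup>+x. ?i x s \<partial>M)
        = (\<integral>\<^sup>+x. indicator {x \<in> space M. f x \<le> s \<and> s < g x} x \<partial>M)"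
      by (intro nn_integral_cong) (simp add: indicator_def)
    also have "\<dots> = emeasure M {x \<in> space M. f x \<le> s \<and> s < g x}"
      by (intro nn_integral_indicator) measurable
    finally show ?thesis .
  qed
  have "(\<integral>\<^sup>+s. ?i x s \<partial>lborel) = ennreal (g x - f x)" for x
  proof -
    have "{s. f x \<le> s \<and> s < g x} = {f x..<g x}" by auto
    then show ?thesis by (cases "f x \<le> g x") (auto simp: ennreal_neg)
  qed
  then show "(\<integral>\<^sup>+x. ennreal (g x - f x) \<partial>M)
      = (\<integral>\<^sup>+s. emeasure M {x \<in> space M. f x \<le> s \<and> s < g x} \<partial>lborel)"
    using Fubini'[of ?i] by (simp add: layer)
  have "(\<lambda>s. \<integral>\<^sup>+x. ?i x s \<partial>M) \<in> borel_measurable lborel"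
    by measurable
  then show "(\<lambda>s. emeasure M {x \<in> space M. f x \<le> s \<and> s < g x}) \<in> borel_measurable borel"
    by (simp add: layer)
qed

end

section \<open>Coarea inequality\<close>

text \<open>Restricting a lower limit to one sequence can only increase it; Fatou's lemma needs a
  sequence.\<close>

lemma perimeter_le_liminf:
  assumes "\<And>n. 0 < h n" "h \<longlonglongrightarrow> 0"
  shows "perimeter M A
    \<le> liminf (\<lambda>n. (emeasure M (enlargement A (h n)) - emeasure M A) / ennreal (h n))"
proof -
  have "filterlim h (at_right 0) sequentially"
    using assms by (intro tendsto_imp_filterlim_at_right) auto
  then have le: "filtermap h sequentially \<le> at_right 0"
    by (simp add: filterlim_def)
  let ?q = "\<lambda>h. (emeasure M (enlargement A h) - emeasure M A) / ennreal h"
  have "perimeter M A \<le> Liminf (filtermap h sequentially) ?q"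
    unfolding perimeter_def Liminf_def using le by (intro SUP_subset_mono) (auto simp: le_filter_def)
  also have "\<dots> \<le> liminf (\<lambda>n. ?q (h n))" by (rule Liminf_filtermap_le)
  finally show ?thesis .
qed

lemma coarea_inequality:
  fixes M :: "'a::metric_space measure" and f :: "'a \<Rightarrow> real"
  assumes "finite_measure M" and sets: "sets M = sets borel"
    and lip: "L-lipschitz_on UNIV f"
  shows "(\<integral>\<^sup>+s. perimeter M {x. s < f x} \<partial>lborel) \<le> (\<integral>\<^sup>+x. grad_norm f x \<partial>M)"
proof -
  interpret finite_measure M by fact
  have space: "space M = UNIV" using sets_eq_imp_space_eq[OF sets] by simp
  note sets[measurable_cong]
  have [measurable]: "f \<in> borel_measurable borel"
    using lipschitz_on_continuous_on[OF lip] by (rule borel_measurable_continuous_onI)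
  define h where "h n = inverse (real (Suc n))" for n
  have h: "0 < h n" for n by (simp add: h_def)
  have h_lim: "h \<longlonglongrightarrow> 0" unfolding h_def by (rule LIMSEQ_inverse_real_of_nat)
  have [measurable]: "sup_ball f (h n) \<in> borel_measurable borel" for n
    by (rule borel_measurable_sup_ball[OF lip h])
  \<comment> \<open>Written as the measure of a layer, the growth of measure under enlargement is
    measurable in \<open>s\<close>, as Fatou's lemma requires.\<close>
  let ?D = "\<lambda>n s. emeasure M {x \<in> space M. f x \<le> s \<and> s < sup_ball f (h n) x}"
  have [measurable]: "?D n \<in> borel_measurable borel" for n
    by (rule borel_measurable_layer) measurable
  have D: "?D n s = emeasure M (enlargement {x. s < f x} (h n)) - emeasure M {x. s < f x}" for n s
  proof -
    have "{x. s < f x} \<subseteq> {x. s < sup_ball f (h n) x}"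
      using sup_ball_upper[OF lip h] by (auto intro: less_le_trans)
    then have "emeasure M ({x. s < sup_ball f (h n) x} - {x. s < f x})
        = emeasure M {x. s < sup_ball f (h n) x} - emeasure M {x. s < f x}"
      by (intro emeasure_Diff) (auto simp: sets)
    moreover have "{x. s < sup_ball f (h n) x} - {x. s < f x}
        = {x \<in> space M. f x \<le> s \<and> s < sup_ball f (h n) x}"
      by (auto simp: space)
    ultimately show ?thesis by (simp add: superlevel_sup_ball[OF lip h])
  qed
  have "(\<integral>\<^sup>+s. perimeter M {x. s < f x} \<partial>lborel)
      \<le> (\<integral>\<^sup>+s. liminf (\<lambda>n. ?D n s / ennreal (h n)) \<partial>lborel)"
    unfolding D by (intro nn_integral_mono perimeter_le_liminf h h_lim)
  also have "\<dots> \<le> liminf (\<lambda>n. \<integral>\<^sup>+s. ?D n s / ennreal (h n) \<partial>lborel)"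
    by (intro nn_integral_liminf) simp
  also have "(\<lambda>n. \<integral>\<^sup>+s. ?D n s / ennreal (h n) \<partial>lborel)
      = (\<lambda>n. \<integral>\<^sup>+x. ennreal ((sup_ball f (h n) x - f x) / h n) \<partial>M)"
  proof
    fix n
    have "(\<integral>\<^sup>+s. ?D n s / ennreal (h n) \<partial>lborel) = (\<integral>\<^sup>+s. ?D n s \<partial>lborel) / ennreal (h n)"
      by (intro nn_integral_divide) simp
    also have "\<dots> = (\<integral>\<^sup>+x. ennreal (sup_ball f (h n) x - f x) \<partial>M) / ennreal (h n)"
      by (subst layer_cake_diff) simp_all
    also have "\<dots> = (\<integral>\<^sup>+x. ennreal (sup_ball f (h n) x - f x) / ennreal (h n) \<partial>M)"
      by (intro nn_integral_divide[symmetric]) simp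
    finally show "(\<integral>\<^sup>+s. ?D n s / ennreal (h n) \<partial>lborel)
      = (\<integral>\<^sup>+x. ennreal ((sup_ball f (h n) x - f x) / h n) \<partial>M)"
      using sup_ball_upper[OF lip h] h by (simp add: divide_ennreal)
  qed
  also have "liminf \<dots> \<le> limsup \<dots>" by (rule Liminf_le_Limsup) simp
  also have "\<dots> \<le> (\<integral>\<^sup>+x. limsup (\<lambda>n. ennreal ((sup_ball f (h n) x - f x) / h n)) \<partial>M)"
  \<comment> \<open>Reverse Fatou needs an integrable dominating function: the constant
    \<open>L\<close> serves, since \<open>sup_ball f h\<close> exceeds \<open>f\<close> by at most
    \<open>L * h\<close> and the measure is finite.\<close>
  proof (rule nn_integral_limsup[where w = "\<lambda>_. ennreal L"])
    show "(\<integral>\<^sup>+x. ennreal L \<partial>M) < \<infinity>"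
      using emeasure_finite by (auto simp: less_top[symmetric] ennreal_mult_eq_top_iff)
    show "AE x in M. ennreal ((sup_ball f (h n) x - f x) / h n) \<le> ennreal L" for n
    proof (intro AE_I2 ennreal_leI)
      fix x
      show "(sup_ball f (h n) x - f x) / h n \<le> L"
        using sup_ball_le[OF lip h, of n x] h[of n] by (simp add: divide_simps algebra_simps)
    qed
  qed simp_all
  also have "\<dots> \<le> (\<integral>\<^sup>+x. grad_norm f x \<partial>M)"
    by (intro nn_integral_mono limsup_sup_ball_le_grad_norm[OF lip] h h_lim)
  finally show ?thesis .
qed

section \<open>Consequences of concavity and symmetry of the profile\<close>

context isoperimetric_space
begin

lemma iso_profile_nonneg: "0 \<le> iso_profile M t"
  by (simp add: iso_profile_def)

text \<open>\<open>B\<close> competes in the infimum, and finiteness of \<open>ext_profile\<close>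
  on the domain makes \<open>enn2real\<close> lossless.\<close>

lemma iso_profile_le_perimeter:
  assumes "B \<in> sets M" "emeasure M B < emeasure M (space M)"
  shows "ennreal (iso_profile M (measure M B)) \<le> perimeter M B"
proof -
  have fin: "emeasure M B \<noteq> \<infinity>" using assms(2) by auto
  then have B: "emeasure M B = ennreal (measure M B)" by (simp add: emeasure_eq_ennreal_measure)
  then have "measure M B \<in> profile_dom M" using assms(2) by (simp add: profile_dom_def)
  then have "ennreal (iso_profile M (measure M B)) = ext_profile M (measure M B)"
    using profile_finite by (simp add: iso_profile_def)
  also have "\<dots> \<le> perimeter M B"
    unfolding ext_profile_def using assms B by (intro INF_lower) auto
  finally show ?thesis .
qed

text \<open>With \<open>I\<close> the profile, concavity and \<open>I 0 = 0\<close> give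
  \<open>I r \<ge> (r / t) * I t\<close>. By symmetry \<open>I\<close> agrees at \<open>r\<close>
  and \<open>?m - r\<close>, so concavity gives \<open>I u \<ge> I r\<close> in between. Here
  \<open>r\<close> will be the measure of a layer and \<open>u\<close> that of a superlevel
  set.\<close>

lemma le_iso_profile_ratio:
  assumes fin: "emeasure M (space M) < \<infinity>"
    and t: "0 < t" "t < measure M (space M)"
    and r: "0 \<le> r" "r \<le> t" and u: "r \<le> u" "u \<le> measure M (space M) - r"
  shows "r \<le> t / iso_profile M t * iso_profile M u"
proof (cases "r = 0")
  case True
  then show ?thesis using t iso_profile_nonneg by simp
next
  \<comment> \<open>For \<open>r > 0\<close> the point \<open>?m - r\<close> lies in the domain of
    the profile, which excludes \<open>?m\<close>.\<close>
  case False
  let ?m = "measure M (space M)" and ?I = "iso_profile M"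
  have dom: "x \<in> profile_dom M" if "0 \<le> x" "x < ?m" for x
    using that fin by (simp add: profile_dom_def emeasure_eq_ennreal_measure ennreal_lessI)
  have conc: "(1 - c) * ?I x + c * ?I y \<le> ?I ((1 - c) * x + c * y)"
    if "0 \<le> c" "c \<le> 1" "0 \<le> x" "x < ?m" "0 \<le> y" "y < ?m" for c x y
    using concave_onD[OF profile_concave that(1,2) dom dom, of x y] that by simp
  have "r / t * ?I t \<le> ?I r"
    using conc[of "r / t" 0 t] t r profile_zero by simp
  also have "?I r \<le> ?I u"
  proof (cases "u = r")
    case ne: False
    \<comment> \<open>The weight that makes \<open>u\<close> a convex combination of
      \<open>r\<close> and \<open>?m - r\<close>.\<close>
    define c where "c = (u - r) / (?m - r - r)"
    have pos: "0 < ?m - r - r" using u ne by linarith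
    then have c: "0 \<le> c" "c \<le> 1" using u by (simp_all add: c_def)
    have "c * (?m - r - r) = u - r" using pos by (simp add: c_def)
    then have cu: "(1 - c) * r + c * (?m - r) = u" by (simp add: algebra_simps)
    have "?I (?m - r) = ?I r" using False r t fin by (intro profile_symmetric) auto
    then show ?thesis
      using conc[of c r "?m - r"] c cu False r t u by (simp add: algebra_simps)
  qed simp
  finally have "r / t * ?I t \<le> ?I u" .
  moreover have "0 < ?I t" using t dom by (intro profile_pos) auto
  ultimately show ?thesis using t by (simp add: field_simps)
qed

end

section \<open>Comparison of the layers with the perimeters\<close>

theorem theorem1:
  fixes M :: "'a::metric_space measure" and f :: "'a \<Rightarrow> real" and m L :: real and A :: "'a set"
  assumes "isoperimetric_space M"
    and "emeasure M (space M) < \<infinity>"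
    and "L-lipschitz_on UNIV f"
    and "is_median M f m"
    and "A \<in> sets M"
  defines "t \<equiv> min (measure M A) (measure M (space M) / 2)"
  shows "(\<integral>\<^sup>+x\<in>A. ennreal \<bar>f x - m\<bar> \<partial>M)
         \<le> ennreal (t / iso_profile M t) * (\<integral>\<^sup>+x. grad_norm f x \<partial>M)"
proof (cases "measure M A = 0")
  interpret finite_measure M using assms(2) by (intro finite_measureI) auto
  case True
  then have "A \<in> null_sets M" using assms(5) by (simp add: null_sets_def emeasure_eq_measure)
  then have "(\<integral>\<^sup>+x\<in>A. ennreal \<bar>f x - m\<bar> \<partial>M) = 0" by (rule nn_integral_null_set)
  then show ?thesis by simp
next
  case A_pos: False
  interpret isoperimetric_space M by fact
  interpret finite_measure M using assms(2) by (intro finite_measureI) auto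
  have space: "space M = UNIV" using sets_eq_imp_space_eq[OF sets_borel] by simp
  note sets_borel[measurable_cong] assms(5)[measurable]
  have [measurable]: "f \<in> borel_measurable borel"
    using lipschitz_on_continuous_on[OF assms(3)] by (rule borel_measurable_continuous_onI)
  let ?m = "measure M (space M)" and ?c = "t / iso_profile M t"
  have t: "0 < t" "t < ?m"
    using A_pos bounded_measure[of A] measure_nonneg[of M A] unfolding t_def by linarith+
  have "t \<in> profile_dom M" using t by (simp add: profile_dom_def emeasure_eq_measure ennreal_lessI)
  then have c: "0 < ?c" using t profile_pos by simp
  have half: "ennreal (?m / 2) = emeasure M (space M) / 2"
    using divide_ennreal[of ?m 2] by (simp add: emeasure_eq_measure)
  have median: "?m / 2 \<le> measure M {x. m \<le> f x}" "?m / 2 \<le> measure M {x. f x \<le> m}"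
    using assms(4) unfolding is_median_def half[symmetric]
    by (simp_all add: space emeasure_eq_measure)
  \<comment> \<open>On \<open>A\<close> the values \<open>g x\<close> and \<open>g' x\<close> are
    the lesser and the greater of \<open>f x\<close> and \<open>m\<close>, so they differ by
    \<open>\<bar>f x - m\<bar>\<close>; off \<open>A\<close> they coincide and contribute no
    layer.\<close>
  define g where "g x = (if x \<in> A then min (f x) m else m)" for x
  define g' where "g' x = (if x \<in> A then max (f x) m else m)" for x
  have [measurable]: "g \<in> borel_measurable M" "g' \<in> borel_measurable M"
    unfolding g_def g'_def by measurable
  have "(\<integral>\<^sup>+x\<in>A. ennreal \<bar>f x - m\<bar> \<partial>M) = (\<integral>\<^sup>+x. ennreal (g' x - g x) \<partial>M)"
    by (intro nn_integral_cong) (auto simp: g_def g'_def)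
  also have "\<dots> = (\<integral>\<^sup>+s. emeasure M {x \<in> space M. g x \<le> s \<and> s < g' x} \<partial>lborel)"
    by (rule layer_cake_diff) measurable
  also have "\<dots> \<le> (\<integral>\<^sup>+s. ennreal ?c * perimeter M {x. s < f x} \<partial>lborel)"
  proof (rule nn_integral_mono)
    fix s
    let ?S = "{x \<in> space M. g x \<le> s \<and> s < g' x}" and ?U = "{x. s < f x}"
    have [simp]: "?S \<in> sets M" by measurable
    have [simp]: "{x. p (f x)} \<in> sets M" if "{x. p x} \<in> sets borel" for p
    proof -
      have "f -` {x. p x} \<in> sets borel"
        using measurable_sets[OF \<open>f \<in> borel_measurable borel\<close> that] by simp
      then show ?thesis by (simp add: sets_borel vimage_def)
    qed
    have compl: "measure M {x. \<not> p (f x)} = ?m - measure M {x. p (f x)}"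
      if "{x. p x} \<in> sets borel" for p
    proof -
      have "measure M (space M - {x. p (f x)}) = ?m - measure M {x. p (f x)}"
        using that by (intro finite_measure_compl) simp
      moreover have "space M - {x. p (f x)} = {x. \<not> p (f x)}" by (auto simp: space)
      ultimately show ?thesis by simp
    qed
    have SA: "measure M ?S \<le> measure M A"
      by (intro finite_measure_mono) (auto simp: g_def g'_def split: if_splits)
    \<comment> \<open>These bounds and \<open>SA\<close> supply the hypotheses of
      \<open>le_iso_profile_ratio\<close> with \<open>r\<close> the measure of \<open>?S\<close> and
      \<open>u\<close> that of \<open>?U\<close>.\<close>
    have bounds: "measure M ?S \<le> ?m / 2" "measure M ?S \<le> measure M ?U"
      "measure M ?U \<le> ?m - measure M ?S"
    proof -
      have "measure M ?S \<le> ?m / 2 \<and> measure M ?S \<le> measure M ?U \<and> measure M ?U \<le> ?m - measure M ?S"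
      proof (cases "m \<le> s")
        \<comment> \<open>Above the median
          \<open>?S \<subseteq> ?U \<subseteq> {x. m < f x}\<close>, and the last set has at most
          half the mass.\<close>
        case True
        have "measure M ?S \<le> measure M ?U"
          using True by (intro finite_measure_mono) (auto simp: g_def g'_def split: if_splits)
        moreover have "measure M ?U \<le> measure M {x. \<not> f x \<le> m}"
          using True by (intro finite_measure_mono) auto
        ultimately show ?thesis using median(2) compl[of "\<lambda>y. y \<le> m"] by simp
      next
        \<comment> \<open>Below the median \<open>?S\<close> lies in the complement of
          \<open>?U\<close>, which lies in \<open>{x. f x < m}\<close> and so has at most half the
          mass; hence \<open>?U\<close> has at least half.\<close>
        case False
        have "measure M ?S \<le> measure M {x. \<not> s < f x}"
          using False by (intro finite_measure_mono) (auto simp: g_def g'_def split: if_splits)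
        moreover have "measure M {x. \<not> s < f x} \<le> measure M {x. \<not> m \<le> f x}"
          using False by (intro finite_measure_mono) auto
        ultimately show ?thesis
          using median(1) compl[of "\<lambda>y. m \<le> y"] compl[of "\<lambda>y. s < y"] by simp
      qed
      then show "measure M ?S \<le> ?m / 2" "measure M ?S \<le> measure M ?U"
        "measure M ?U \<le> ?m - measure M ?S" by auto
    qed
    show "emeasure M ?S \<le> ennreal ?c * perimeter M ?U"
    proof (cases "measure M ?S = 0")
      case True
      then show ?thesis by (simp add: emeasure_eq_measure)
    next
      case False
      then have "0 < measure M ?S" using measure_nonneg[of M ?S] by linarith
      \<comment> \<open>A layer of positive measure forces \<open>?U\<close> to miss positive mass,
        which puts its measure in the domain of the profile.\<close>
      then have "measure M ?U < ?m" using bounds by linarith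
      then have "ennreal (iso_profile M (measure M ?U)) \<le> perimeter M ?U"
        by (intro iso_profile_le_perimeter) (simp_all add: emeasure_eq_measure ennreal_less_iff)
      moreover have "measure M ?S \<le> ?c * iso_profile M (measure M ?U)"
        using bounds SA t assms(2) by (intro le_iso_profile_ratio) (auto simp: t_def)
      then have "emeasure M ?S \<le> ennreal ?c * ennreal (iso_profile M (measure M ?U))"
        using c iso_profile_nonneg
        by (simp add: emeasure_eq_measure ennreal_mult[symmetric] ennreal_leI)
      ultimately show ?thesis by (meson mult_left_mono order_trans zero_le)
    qed
  qed
  also have "\<dots> \<le> ennreal ?c * (\<integral>\<^sup>+s. perimeter M {x. s < f x} \<partial>lborel)"
    using c by (intro nn_integral_cmult_le) auto
  also have "\<dots> \<le> ennreal ?c * (\<integral>\<^sup>+x. grad_norm f x \<partial>M)"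
    by (intro mult_left_mono coarea_inequality[OF finite_measure_axioms sets_borel assms(3)]) simp
  finally show ?thesis .
qed

end
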